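(* Let $A(E_8)$ be the Cartan matrix of the root system $E_8$ (Bourbaki numbering) $$A(E_8) = \begin{pmatrix} 2 & 0 & -1 & 0 & 0 & 0 & 0 & 0 \\ 0 & 2 & 0 & -1 & 0 & 0 & 0 & 0 \\ -1 & 0 & 2 & -1 & 0 & 0 & 0 & 0 \\ 0 & -1 & -1 & 2 & -1 & 0 & 0 & 0 \\ 0 & 0 & 0 & -1 & 2 & -1 & 0 & 0 \\ 0 & 0 & 0 & 0 & -1 & 2 & -1 & 0 \\ 0 & 0 & 0 & 0 & 0 & -1 & 2 & -1 \\ 0 & 0 & 0 & 0 & 0 & 0 & -1 & 2 \end{pmatrix}.$$ Let $\delta = \frac{\pi}{2}$, and for integers $1\le a\le 4$, $1\le b\le 2$ let $\theta = \frac{a\pi}{5}$, $\gamma = \frac{b\pi}{3}$ and $$\alpha = \theta+\gamma+\delta = \pi + \frac{k\pi}{30},\qquad k\in\{1,7,11,13,17,19,23,29\}.$$ Then the $8$ eigenvalues of $A(E_8)$ are the numbers $$\lambda(\theta,\gamma) = 2 - 2\cos\alpha$$ for the $8$ pairs $(a,b)$, and for each such pair the vector $$X_{E_8}(\theta,\gamma) = \begin{pmatrix} \cos(\gamma + \theta - \delta) + \cos ( \gamma - 3 \theta - \delta) + \cos (\gamma - \theta - \delta) \\ \cos( 2 \gamma + 2 \theta)\\ \cos(2\gamma) + \cos (2\gamma + 2 \theta) + \cos ( 2\gamma - 2 \theta) + \cos (4\theta) + \cos(2 \theta) \\ \cos(\gamma + 3 \theta - \delta) + \cos ( \gamma + \theta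 - \delta ) + \cos ( -\gamma + 3 \theta - \delta) \\ 2 \cos(2\gamma) + 2 \cos(2 \gamma + 2 \theta) + \cos(2\gamma - 2 \theta) + \cos(2 \gamma + 4 \theta) + \cos(4\theta) + 2 \cos (2 \theta) + 1 \\ \cos(\gamma + 3 \theta - \delta) + \cos( \gamma + \theta - \delta) \\ \cos (2 \gamma) + \cos ( 2 \theta - 2 \delta) \\ \cos (\gamma - \theta - \delta ) \end{pmatrix}$$ is an eigenvector of $A(E_8)$ with eigenvalue $\lambda(\theta,\gamma)$.
   Context: The matrix acts on column vectors. An eigenvector is by definition nonzero. *)

theory Defs
  imports Complex_Main "Jordan_Normal_Form.Spectral_Radius"
begin

definition cartan_E8 :: "real mat" where
  "cartan_E8 = mat_of_rows_list 8
    [[ 2,  0, -1,  0,  0,  0,  0,  0],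
     [ 0,  2,  0, -1,  0,  0,  0,  0],
     [-1,  0,  2, -1,  0,  0,  0,  0],
     [ 0, -1, -1,  2, -1,  0,  0,  0],
     [ 0,  0,  0, -1,  2, -1,  0,  0],
     [ 0,  0,  0,  0, -1,  2, -1,  0],
     [ 0,  0,  0,  0,  0, -1,  2, -1],
     [ 0,  0,  0,  0,  0,  0, -1,  2]]"

definition delta :: real where
  "delta = pi / 2"

definition theta :: "int \<Rightarrow> real" where
  "theta a = of_int a * pi / 5"

definition gamma :: "int \<Rightarrow> real" where
  "gamma b = of_int b * pi / 3"

definition alpha :: "real \<Rightarrow> real \<Rightarrow> real" where
  "alpha \<theta> \<gamma> = \<theta> + \<gamma> + delta"

definition lambda_E8 :: "real \<Rightarrow> real \<Rightarrow> real" where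
  "lambda_E8 \<theta> \<gamma> = 2 - 2 * cos (alpha \<theta> \<gamma>)"

definition X_E8 :: "real \<Rightarrow> real \<Rightarrow> real vec" where
  "X_E8 \<theta> \<gamma> = vec_of_list
    [cos (\<gamma> + \<theta> - delta) + cos (\<gamma> - 3 * \<theta> - delta) + cos (\<gamma> - \<theta> - delta),
     cos (2 * \<gamma> + 2 * \<theta>),
     cos (2 * \<gamma>) + cos (2 * \<gamma> + 2 * \<theta>) + cos (2 * \<gamma> - 2 * \<theta>)
       + cos (4 * \<theta>) + cos (2 * \<theta>),
     cos (\<gamma> + 3 * \<theta> - delta) + cos (\<gamma> + \<theta> - delta) + cos (- \<gamma> + 3 * \<theta> - delta),
     2 * cos (2 * \<gamma>) + 2 * cos (2 * \<gamma> + 2 * \<theta>) + cos (2 * \<gamma> - 2 * \<theta>)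
       + cos (2 * \<gamma> + 4 * \<theta>) + cos (4 * \<theta>) + 2 * cos (2 * \<theta>) + 1,
     cos (\<gamma> + 3 * \<theta> - delta) + cos (\<gamma> + \<theta> - delta),
     cos (2 * \<gamma>) + cos (2 * \<theta> - 2 * delta),
     cos (\<gamma> - \<theta> - delta)]"

end

(* For all b we have cos(2 gamma) = -1/2, and since sin(5 theta) = 0 with sin(theta) nonzero,
   1 + 2 cos(2 theta) + 2 cos(4 theta) = 0 for all a.
   Modulo these two relations the eight row equations of A X = lambda X become trigonometric
   identities valid for all eight pairs at once. The eight values lambda are distinct because
   alpha lies in [pi, 2 pi], where cos is injective, so they exhaust the spectrum. *)

theory Submission
  imports Defs
begin

lemma cartan_E8_carrier: "cartan_E8 \<in> carrier_mat 8 8"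
  by (auto simp: cartan_E8_def mat_of_rows_list_def)

text \<open>Multiplies out the matrix once with symbolic entries, so that the eigenvector equation
  reduces to eight scalar equations.\<close>

lemma cartan_E8_mult_vec_of_list:
  "cartan_E8 *\<^sub>v vec_of_list [x1, x2, x3, x4, x5, x6, x7, x8] =
    vec_of_list [2 * x1 - x3, 2 * x2 - x4, 2 * x3 - x1 - x4, 2 * x4 - x2 - x3 - x5,
      2 * x5 - x4 - x6, 2 * x6 - x5 - x7, 2 * x7 - x6 - x8, 2 * x8 - x7]"
proof (rule eq_vecI)
  fix i
  assume "i < dim_vec (vec_of_list [2 * x1 - x3, 2 * x2 - x4, 2 * x3 - x1 - x4,
      2 * x4 - x2 - x3 - x5, 2 * x5 - x4 - x6, 2 * x6 - x5 - x7, 2 * x7 - x6 - x8, 2 * x8 - x7])"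
  then have "i \<in> {0, 1, 2, 3, 4, 5, 6, 7}" by auto
  then show "(cartan_E8 *\<^sub>v vec_of_list [x1, x2, x3, x4, x5, x6, x7, x8]) $ i =
    vec_of_list [2 * x1 - x3, 2 * x2 - x4, 2 * x3 - x1 - x4, 2 * x4 - x2 - x3 - x5,
      2 * x5 - x4 - x6, 2 * x6 - x5 - x7, 2 * x7 - x6 - x8, 2 * x8 - x7] $ i"
    by (elim insertE emptyE) (simp_all add: cartan_E8_def mat_of_rows_list_def
      scalar_prod_def vec_of_list_index numeral_eq_Suc sum.atLeast0_lessThan_Suc)
qed (simp add: cartan_E8_def mat_of_rows_list_def)

lemma smult_vec_of_list: "a \<cdot>\<^sub>v vec_of_list xs = vec_of_list (map ((*) a) xs)"
  by (rule eq_vecI) (auto simp: vec_of_list_index)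

text \<open>Like the two expansions below, serves to turn every multiple angle into a polynomial in
  \<open>cos x\<close> times at most one factor \<open>sin x\<close>.\<close>

lemma cos_quadruple_cos: "cos (4 * x) = 8 * cos x ^ 4 - 8 * (cos x)\<^sup>2 + 1" for x :: real
proof -
  have "cos (4 * x) = 2 * (2 * (cos x)\<^sup>2 - 1)\<^sup>2 - 1"
    using cos_double_cos[of "2 * x"] by (simp add: cos_double_cos[of x])
  also have "\<dots> = 8 * cos x ^ 4 - 8 * (cos x)\<^sup>2 + 1"
    by (simp add: algebra_simps power2_eq_square power4_eq_xxxx)
  finally show ?thesis .
qed

lemma sin_quadruple: "sin (4 * x) = 4 * sin x * (2 * cos x ^ 3 - cos x)" for x :: real
proof -
  have "sin (4 * x) = 2 * (2 * sin x * cos x) * (2 * (cos x)\<^sup>2 - 1)"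
    using sin_double[of "2 * x"] by (simp add: sin_double[of x] cos_double_cos[of x])
  also have "\<dots> = 4 * sin x * (2 * cos x ^ 3 - cos x)"
    by (simp add: algebra_simps power2_eq_square power3_eq_cube)
  finally show ?thesis .
qed

lemma sin_treble: "sin (3 * x) = sin x * (4 * (cos x)\<^sup>2 - 1)" for x :: real
proof -
  have "sin (3 * x) = 2 * sin x * cos x * cos x + (2 * (cos x)\<^sup>2 - 1) * sin x"
    using sin_add[of "2 * x" x] by (simp add: sin_double[of x] cos_double_cos[of x])
  also have "\<dots> = sin x * (4 * (cos x)\<^sup>2 - 1)"
    by (simp add: algebra_simps power2_eq_square)
  finally show ?thesis .
qed

lemma cartan_E8_mult_eigen:
  assumes g: "1 + 2 * cos (2 * \<gamma>) = 0"
    and t: "1 + 2 * cos (2 * \<theta>) + 2 * cos (4 * \<theta>) = 0"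
  shows "cartan_E8 *\<^sub>v X_E8 \<theta> \<gamma> = lambda_E8 \<theta> \<gamma> \<cdot>\<^sub>v X_E8 \<theta> \<gamma>"
proof -
  define s c S C where "s = sin \<theta>" and "c = cos \<theta>" and "S = sin \<gamma>" and "C = cos \<gamma>"
  note sc = s_def c_def S_def C_def
  have delta: "cos (x - delta) = sin x" "cos (x + delta) = - sin x" for x
    by (simp_all add: delta_def cos_diff cos_add)
  have "2 * delta = pi" by (simp add: delta_def)
  then have delta2: "cos (x - 2 * delta) = - cos x" for x
    by (simp add: cos_diff)
  note ex = cos_double_cos sin_double cos_treble_cos sin_treble cos_quadruple_cos sin_quadruple
    cos_add cos_diff sin_add sin_diff
  \<comment> \<open>Substituting the expansions, \<open>g\<close> becomes
    \<open>4 * C^2 - 1 = 0\<close> and \<open>t\<close> becomes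
    \<open>16 * c^4 - 12 * c^2 + 1 = 0\<close>.\<close>
  have r1: "s\<^sup>2 = 1 - c\<^sup>2" and r2: "S\<^sup>2 = 3 / 4" and r3: "C\<^sup>2 = 1 / 4"
    and r4: "16 * c ^ 4 = 12 * c\<^sup>2 - 1"
    using g t by (auto simp: sc ex sin_squared_eq)
  (* As left-to-right rewrite rules, e and e' compute normal forms modulo the ideal of relations
     between s, c, S and C, so that the row equations become provable by rewriting. *)
  have e: "s * s = 1 - c * c" "S * S = 3 / 4" "C * C = 1 / 4"
    "c * (c * (c * c)) = 3 / 4 * (c * c) - 1 / 16"
    using r1 r2 r3 r4 by (simp_all add: power2_eq_square power4_eq_xxxx)
  have e': "s * (s * x) = x - c * (c * x)" "S * (S * x) = 3 / 4 * x" "C * (C * x) = 1 / 4 * x"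
    "c * (c * (c * (c * x))) = 3 / 4 * (c * (c * x)) - 1 / 16 * x" for x
    using e[THEN arg_cong[where f = "\<lambda>y. y * x"]] by (simp_all add: algebra_simps)
  show ?thesis
    unfolding X_E8_def cartan_E8_mult_vec_of_list smult_vec_of_list lambda_E8_def alpha_def
    apply (simp only: delta delta2 list.map)
    apply (simp only: ex)
    apply (simp add: sc[symmetric])
    \<comment> \<open>Products are nested to the right here: \<open>e\<close> matches a reducible
      power at the end of a product, \<open>e'\<close> one followed by further factors.\<close>
    apply (simp add: algebra_simps e e' power2_eq_square power3_eq_cube power4_eq_xxxx)
    done
qed

lemma gamma_relation:
  assumes "b \<in> {1..2}"
  shows "1 + 2 * cos (2 * gamma b) = 0"
proof -
  \<comment> \<open>This settles \<open>b = 2\<close>, where the doubled angle is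
    \<open>4 * pi / 3\<close>; for \<open>b = 1\<close> it is \<open>2 * pi / 3\<close>.\<close>
  have "cos (2 * (2 * pi / 3)) = - 1 / 2"
    unfolding cos_double_cos cos_120 by (simp add: power2_eq_square)
  moreover have "b = 1 \<or> b = 2" using assms by auto
  ultimately show ?thesis
    using cos_120 by (auto simp: gamma_def)
qed

lemma theta_relation:
  assumes "a \<in> {1..4}"
  shows "1 + 2 * cos (2 * theta a) + 2 * cos (4 * theta a) = 0"
proof -
  let ?t = "theta a"
  \<comment> \<open>The product telescopes:
    \<open>2 * sin t * cos (2 * t) = sin (3 * t) - sin t\<close> and
    \<open>2 * sin t * cos (4 * t) = sin (5 * t) - sin (3 * t)\<close>.\<close>
  have "sin ?t * (1 + 2 * cos (2 * ?t) + 2 * cos (4 * ?t)) = sin (5 * ?t)"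
    using sin_add[of "4 * ?t" "?t"] sin_diff[of "4 * ?t" "?t"] sin_add[of "2 * ?t" "?t"]
      sin_diff[of "2 * ?t" "?t"] by (simp add: algebra_simps)
  also have "\<dots> = 0"
    by (simp add: theta_def sin_zero_iff_int2)
  \<comment> \<open>The factor \<open>sin ?t\<close> cancels because \<open>?t\<close> lies strictly
    between 0 and \<open>pi\<close>.\<close>
  finally show ?thesis
    using assms sin_gt_zero[of ?t] by (auto simp: theta_def)
qed

text \<open>Over the denominator 30, the offset -15 is \<open>delta - pi\<close>.\<close>

lemma alpha_theta_gamma:
  "alpha (theta a) (gamma b) = pi + of_int (6 * a + 10 * b - 15) * pi / 30"
  by (simp add: alpha_def theta_def gamma_def delta_def field_simps)

text \<open>The last entry, \<open>sin (gamma b - theta a)\<close>, already suffices: it vanishes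
  only if 15 divides \<open>5 * b - 3 * a\<close>, which would force 3 to divide
  \<open>b\<close>.\<close>

lemma X_E8_nonzero:
  assumes "a \<in> {1..4}" "b \<in> {1..2}"
  shows "X_E8 (theta a) (gamma b) \<noteq> 0\<^sub>v 8"
proof
  assume "X_E8 (theta a) (gamma b) = 0\<^sub>v 8"
  then have "X_E8 (theta a) (gamma b) $ 7 = 0" by simp
  then have "sin (gamma b - theta a) = 0"
    by (simp add: X_E8_def vec_of_list_index numeral_eq_Suc cos_diff delta_def)
  then obtain i where "gamma b - theta a = of_int i * pi"
    using sin_zero_iff_int2 by blast
  then have "pi * real_of_int (5 * b - 3 * a) = pi * real_of_int (15 * i)"
    by (simp add: gamma_def theta_def field_simps)
  then have "5 * b - 3 * a = 15 * i" using pi_neq_zero by (simp only: mult_cancel_left of_int_eq_iff) simp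
  then show False using assms unfolding atLeastAtMost_iff by presburger
qed

lemma X_E8_carrier: "X_E8 \<theta> \<gamma> \<in> carrier_vec 8"
  by (rule carrier_vecI) (simp add: X_E8_def)

lemma eigenvector_X_E8:
  assumes "a \<in> {1..4}" "b \<in> {1..2}"
  shows "eigenvector cartan_E8 (X_E8 (theta a) (gamma b)) (lambda_E8 (theta a) (gamma b))"
  unfolding eigenvector_def carrier_matD(1)[OF cartan_E8_carrier]
  by (intro conjI X_E8_carrier X_E8_nonzero cartan_E8_mult_eigen gamma_relation theta_relation assms)

lemma inj_on_lambda_E8:
  "inj_on (\<lambda>(a, b). lambda_E8 (theta a) (gamma b)) ({1..4} \<times> {1..2})"
proof (rule inj_onI, clarify)
  fix a b a' b' :: int
  assume ab: "a \<in> {1..4}" "b \<in> {1..2}" and ab': "a' \<in> {1..4}" "b' \<in> {1..2}"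
    and eq: "lambda_E8 (theta a) (gamma b) = lambda_E8 (theta a') (gamma b')"
  define k k' where "k = 6 * a + 10 * b - 15" and "k' = 6 * a' + 10 * b' - 15"
  have "0 \<le> k" "k \<le> 30" "0 \<le> k'" "k' \<le> 30"
    using ab ab' by (auto simp: k_def k'_def)
  then have "of_int k * pi / 30 \<in> {0..pi}" "of_int k' * pi / 30 \<in> {0..pi}"
    by (auto simp: field_simps)
  \<comment> \<open>The shift by \<open>pi\<close> only changes the sign of the cosine, on both
    sides alike.\<close>
  moreover have "cos (of_int k * pi / 30) = cos (of_int k' * pi / 30)"
    using eq by (simp add: lambda_E8_def alpha_theta_gamma k_def k'_def cos_add)
  ultimately have "of_int k * pi / 30 = of_int k' * pi / 30"
    by (metis cos_inj_pi atLeastAtMost_iff)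
  then have "k = k'" by simp
  moreover have "b = 1 \<or> b = 2" "b' = 1 \<or> b' = 2" using ab ab' by auto
  \<comment> \<open>From \<open>3 * (a - a') = 5 * (b' - b)\<close>, 3 divides
    \<open>b' - b\<close>, which is at most 1 in absolute value.\<close>
  ultimately show "a = a' \<and> b = b'"
    unfolding k_def k'_def by presburger
qed

theorem mainTheorem1:
  shows "(\<lambda>(a, b). alpha (theta a) (gamma b)) ` ({1..4} \<times> {1..2})
           = (\<lambda>k::int. pi + of_int k * pi / 30) ` {1, 7, 11, 13, 17, 19, 23, 29}
       \<and> bij_betw (\<lambda>(a, b). lambda_E8 (theta a) (gamma b)) ({1..4} \<times> {1..2})
           (spectrum cartan_E8)
       \<and> (\<forall>a\<in>{1..4}. \<forall>b\<in>{1..2}.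
           eigenvector cartan_E8 (X_E8 (theta a) (gamma b)) (lambda_E8 (theta a) (gamma b)))"
proof (intro conjI ballI)
  have k: "(\<lambda>(a, b). 6 * a + 10 * b - 15) ` ({1..4} \<times> {1..2})
      = {1, 7, 11, 13, 17, 19, 23, 29 :: int}"
    by code_simp
  show "(\<lambda>(a, b). alpha (theta a) (gamma b)) ` ({1..4} \<times> {1..2})
      = (\<lambda>k::int. pi + of_int k * pi / 30) ` {1, 7, 11, 13, 17, 19, 23, 29}"
    unfolding k[symmetric] image_image alpha_theta_gamma by (rule image_cong) auto
next
  let ?f = "\<lambda>(a, b). lambda_E8 (theta a) (gamma b)"
  have sub: "?f ` ({1..4} \<times> {1..2}) \<subseteq> spectrum cartan_E8"
    unfolding spectrum_def eigenvalue_def using eigenvector_X_E8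
    by (intro image_subsetI) (simp only: mem_Sigma_iff mem_Collect_eq split_paired_all prod.case, blast)
  have "card (?f ` ({1..4} \<times> {1..2})) = 8"
    using card_image[OF inj_on_lambda_E8] by simp
  \<comment> \<open>A matrix of size 8 has at most 8 eigenvalues, so a subset of the spectrum with 8
    elements is all of it.\<close>
  then have "?f ` ({1..4} \<times> {1..2}) = spectrum cartan_E8"
    using card_finite_spectrum[OF cartan_E8_carrier] sub by (metis card_seteq)
  then show "bij_betw ?f ({1..4} \<times> {1..2}) (spectrum cartan_E8)"
    using inj_on_lambda_E8 by (simp add: bij_betw_def)
next
  fix a b :: int
  assume "a \<in> {1..4}" "b \<in> {1..2}"
  then show "eigenvector cartan_E8 (X_E8 (theta a) (gamma b)) (lambda_E8 (theta a) (gamma b))"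
    by (rule eigenvector_X_E8)
qed

end
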